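(* Let $0<a<b<\infty$ and assign to the edges of the $\mathbb{Z}^2$ nearest-neighbour lattice independent weights $(\omega_e)$, each uniformly distributed on $\{a,b\}$. For any $\alpha<1/22$, any sequence $(k_n)_{n\ge1}$ of positive integers with $k_n\le n^\alpha$, and any fixed $c>0$, we have $$\sup_{x\ge0}\mathbb{P}\big(\tau(n,k_n)\in[x,x+c]\big)=o\Big(\frac{1}{n^{1/22}}\Big)\quad\text{as }n\to\infty.$$
   Context: For a path $\Gamma$, $T(\Gamma):=\sum_{e\in\Gamma}\omega_e$. For $k\ge1$, $\mathcal{P}_k(n)$ is the set of nearest-neighbour paths contained in $[0,n]\times[0,n-1]$ that connect the left side $\{0\}\times[0,n-1]$ to the right side $\{n\}\times[0,n-1]$ and are contained in $[0,n]\times[m,m+k-1]$ for some integer $m$; and $\tau(n,k):=\inf\{T(\Gamma):\Gamma\in\mathcal{P}_k(n)\}$. *)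

theory Defs
  imports "HOL-Probability.Probability" "HOL-Library.Landau_Symbols"
begin

type_synonym vertex = "int \<times> int"
type_synonym edge = "vertex set"

definition adjacent :: "vertex \<Rightarrow> vertex \<Rightarrow> bool" where
  "adjacent u v \<longleftrightarrow> \<bar>fst u - fst v\<bar> + \<bar>snd u - snd v\<bar> = 1"

definition lattice_edges :: "edge set" where
  "lattice_edges = {{u, v} | u v. adjacent u v}"

definition weight_space :: "real \<Rightarrow> real \<Rightarrow> (edge \<Rightarrow> real) measure" where
  "weight_space a b = PiM lattice_edges (\<lambda>_. measure_pmf (pmf_of_set {a, b}))"

definition nn_path :: "vertex list \<Rightarrow> bool" where
  "nn_path xs \<longleftrightarrow> xs \<noteq> [] \<and> (\<forall>i. Suc i < length xs \<longrightarrow> adjacent (xs ! i) (xs ! Suc i))"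

definition path_edges :: "vertex list \<Rightarrow> edge set" where
  "path_edges xs = {{xs ! i, xs ! Suc i} | i. Suc i < length xs}"

definition passage_time :: "(edge \<Rightarrow> real) \<Rightarrow> vertex list \<Rightarrow> real" where
  "passage_time \<omega> xs = (\<Sum>e\<in>path_edges xs. \<omega> e)"

definition paths_k :: "nat \<Rightarrow> nat \<Rightarrow> vertex list set" where
  "paths_k n k = {xs. nn_path xs
     \<and> (\<forall>v\<in>set xs. 0 \<le> fst v \<and> fst v \<le> int n \<and> 0 \<le> snd v \<and> snd v \<le> int n - 1)
     \<and> fst (hd xs) = 0 \<and> fst (last xs) = int n
     \<and> (\<exists>m::int. \<forall>v\<in>set xs. m \<le> snd v \<and> snd v \<le> m + int k - 1)}"

definition tau :: "nat \<Rightarrow> nat \<Rightarrow> (edge \<Rightarrow> real) \<Rightarrow> real" where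
  "tau n k \<omega> = Inf (passage_time \<omega> ` paths_k n k)"

end

theory Submission
  imports Defs "HOL-Real_Asymp.Real_Asymp"
begin

text \<open>A configuration is the set \<open>B\<close> of edges of weight \<open>b\<close>, and probabilities are proportions of
  the subsets of a finite edge set. For a strip \<open>m\<close> let \<open>G\<close> be the event that the minimal passage
  time is below \<open>x\<close> and that every path faster than \<open>x\<close> meets the strip. \<open>G\<close> persists when an
  edge of the strip is lowered from \<open>b\<close> to \<open>a\<close>, so the number of pairs of configurations by which
  one leaves \<open>G\<close> when raising an edge of the strip is the sum over \<open>G\<close> of the difference between
  the numbers of \<open>a\<close>-edges and \<open>b\<close>-edges in the strip, typically at most of order \<open>sqrt (n k)\<close>.
  On the other hand, if the minimum lies in \<open>[x, x + b - a)\<close> and is attained in the strip by a path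
  with \<open>d\<close> edges of weight \<open>b\<close>, then lowering any of them leads into \<open>G\<close>. Each configuration
  belongs to at most \<open>2 k\<close> of the events \<open>G\<close>, so the probability is of order \<open>k sqrt (n k) / d\<close>.

  Planar duality gives \<open>d\<close>: as bond percolation on \<open>\<int>\<^sup>2\<close> is self-dual at \<open>1/2\<close>, a
  \<open>k \<times> k\<close> box is crossed by \<open>a\<close>-edges with probability at most \<open>1/2\<close>, and the \<open>n / k\<close> boxes of
  a strip are independent; hence \<open>d\<close> is about \<open>n / k\<close> up to a small power of \<open>n\<close>.\<close>

section \<open>Discrepancy over a decreasing family\<close>

text \<open>Twice the moment generating function of a fair sign, the contribution of a single edge
  to the exponential moment of the discrepancy.\<close>

lemma exp_plus_exp_minus_le:
  fixes l :: real
  assumes "0 \<le> l" "l \<le> 1"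
  shows "exp l + exp (-l) \<le> 2 * exp (l^2)"
proof -
  have 1: "exp l \<le> 1 + l + l^2" using assms exp_bound by blast
  have "exp (-l) * (1 + l) \<le> exp (-l) * exp l"
    by (intro mult_left_mono) auto
  then have "exp (-l) * (1 + l) \<le> 1" by (simp add: exp_minus)
  then have "exp (-l) \<le> 1 / (1 + l)" using assms by (simp add: field_simps)
  \<comment> \<open>Clearing the denominator, since (1 + l)(1 - l + l^2) = 1 + l^3.\<close>
  also have "\<dots> \<le> 1 - l + l^2"
    using assms by (simp add: field_simps power2_eq_square)
  finally have "exp l + exp (-l) \<le> 2 * (1 + l^2)" using 1 by simp
  also have "\<dots> \<le> 2 * exp (l^2)"
    by (intro mult_left_mono exp_ge_add_one_self) auto
  finally show ?thesis .
qed

text \<open>Double counting of moves along edges of \<open>R\<close>: \<open>U\<close> collects the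
  upward moves from \<open>G\<close>, \<open>D\<close> the downward moves from \<open>G\<close>,
  which stay in \<open>G\<close>, and \<open>W\<close> the downward moves from \<open>A\<close> into
  \<open>G\<close>. Reversing a move maps \<open>D\<close> and \<open>W\<close> injectively into
  \<open>U\<close>.\<close>

lemma edge_boundary_le:
  fixes E R :: "'e set" and A G :: "'e set set" and d :: nat
  assumes E: "finite E" and R: "R \<subseteq> E" and G: "G \<subseteq> Pow E" and A: "A \<subseteq> Pow E"
    and disj: "A \<inter> G = {}"
    and down: "\<And>B e. B \<in> G \<Longrightarrow> e \<in> R \<inter> B \<Longrightarrow> B - {e} \<in> G"
    and many: "\<And>B. B \<in> A \<Longrightarrow> d \<le> card {e \<in> R \<inter> B. B - {e} \<in> G}"
  shows "real d * real (card A)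
           \<le> (\<Sum>B\<in>G. real (card (R - B)) - real (card (R \<inter> B)))"
proof -
  define U where "U = (SIGMA B:G. R - B)"
  define D where "D = (SIGMA B:G. R \<inter> B)"
  define W where "W = (SIGMA B:A. {e \<in> R \<inter> B. B - {e} \<in> G})"
  have finR: "finite R" and finG: "finite G" and finA: "finite A"
    using E R G A finite_subset by blast+
  have fin: "finite U" "finite D" "finite W"
    unfolding U_def D_def W_def using finR finG finA by auto
  have "(\<lambda>(B, e). (B - {e}, e)) ` (D \<union> W) \<subseteq> U"
    using down by (auto simp: U_def D_def W_def)
  moreover have "inj_on (\<lambda>(B, e). (B - {e}, e)) (D \<union> W)"
    by (auto simp: inj_on_def D_def W_def)
  ultimately have "card (D \<union> W) \<le> card U"
    using card_inj_on_le fin(1) by blast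
  moreover have "card (D \<union> W) = card D + card W"
    using fin disj by (intro card_Un_disjoint) (auto simp: D_def W_def)
  moreover have "card U = (\<Sum>B\<in>G. card (R - B))"
    using finG finR by (simp add: U_def)
  moreover have "card D = (\<Sum>B\<in>G. card (R \<inter> B))"
    using finG finR by (simp add: D_def)
  moreover have "card W = (\<Sum>B\<in>A. card {e \<in> R \<inter> B. B - {e} \<in> G})"
    using finA finR by (simp add: W_def)
  moreover have "(\<Sum>B\<in>A. card {e \<in> R \<inter> B. B - {e} \<in> G}) \<ge> card A * d"
    using sum_bounded_below[of A d] many by force
  ultimately have "(\<Sum>B\<in>G. card (R \<inter> B)) + card A * d \<le> (\<Sum>B\<in>G. card (R - B))"
    by linarith
  then have "real ((\<Sum>B\<in>G. card (R \<inter> B)) + card A * d) \<le> real (\<Sum>B\<in>G. card (R - B))"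
    by (rule of_nat_mono)
  then show ?thesis
    by (simp add: sum_subtractf mult.commute)
qed

text \<open>The discrepancy is a sum of independent fair signs, so its exponential moment factorizes
  over the edges: \<open>f\<close> is the factor of an edge inside \<open>B\<close>,
  \<open>g\<close> that of an edge outside.\<close>

lemma sum_exp_discrepancy_le:
  fixes E R :: "'e set" and l :: real
  assumes "finite E" "R \<subseteq> E" "card R \<le> N" "0 \<le> l" "l \<le> 1"
  shows "(\<Sum>B\<in>Pow E. exp (l * (real (card (R - B)) - real (card (R \<inter> B)))))
           \<le> 2 ^ card E * exp (l^2 * real N)"
proof -
  define f g where "f e = (if e \<in> R then exp (-l) else 1)"
    and "g e = (if e \<in> R then exp l else 1)" for e
  have finR: "finite R" using assms finite_subset by blast
  have split: "exp (l * (real (card (R - B)) - real (card (R \<inter> B)))) = prod f B * prod g (E - B)"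
    if "B \<in> Pow E" for B
  proof -
    have "finite B" using that assms(1) finite_subset by blast
    then have "prod f B = exp (-l) ^ card (R \<inter> B)"
      by (simp add: f_def prod.If_cases Int_commute)
    moreover have "(E - B) \<inter> R = R - B" using assms(2) by auto
    then have "prod g (E - B) = exp l ^ card (R - B)"
      using assms(1) by (simp add: g_def prod.If_cases)
    ultimately show ?thesis
      by (simp add: exp_of_nat_mult[symmetric] exp_add[symmetric] algebra_simps)
  qed
  have "(\<Sum>B\<in>Pow E. exp (l * (real (card (R - B)) - real (card (R \<inter> B)))))
      = (\<Sum>B\<in>Pow E. prod f B * prod g (E - B))"
    by (intro sum.cong refl split)
  also have "\<dots> = (\<Prod>e\<in>E. f e + g e)"
    using prod_add[OF assms(1), of f g] by simp
  also have "\<dots> \<le> (\<Prod>e\<in>E. 2 * (if e \<in> R then exp (l^2) else 1))"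
    using exp_plus_exp_minus_le[OF assms(4,5)]
    by (intro prod_mono) (auto simp: f_def g_def add.commute)
  also have "\<dots> = 2 ^ card E * exp (l^2) ^ card R"
    using assms(1,2) by (simp add: prod.distrib prod.If_cases Int_absorb1)
  also have "\<dots> \<le> 2 ^ card E * exp (l^2) ^ N"
    using assms(3) by (intro mult_left_mono power_increasing) auto
  also have "exp (l^2) ^ N = exp (l^2 * real N)"
    by (simp add: exp_of_nat_mult[symmetric] mult.commute)
  finally show ?thesis .
qed

section \<open>Crossing paths and planar duality\<close>

text \<open>A count of steps modulo 2: on truth values, inequality is addition.\<close>

fun step_parity :: "(vertex \<Rightarrow> vertex \<Rightarrow> bool) \<Rightarrow> vertex list \<Rightarrow> bool" where
  "step_parity c (u # v # ws) = (c u v \<noteq> step_parity c (v # ws))"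
| "step_parity c _ = False"

lemma path_edges_simps [simp]:
  "path_edges [] = {}" "path_edges [u] = {}"
  "path_edges (u # v # ws) = insert {u, v} (path_edges (v # ws))"
proof -
  show "path_edges [] = {}" "path_edges [u] = {}" by (auto simp: path_edges_def)
  show "path_edges (u # v # ws) = insert {u, v} (path_edges (v # ws))"
  proof (intro set_eqI iffI)
    fix e assume "e \<in> path_edges (u # v # ws)"
    then obtain i where i: "Suc i < length (u # v # ws)"
      "e = {(u # v # ws) ! i, (u # v # ws) ! Suc i}"
      unfolding path_edges_def by blast
    then show "e \<in> insert {u, v} (path_edges (v # ws))"
      by (cases i) (auto simp: path_edges_def)
  next
    fix e assume "e \<in> insert {u, v} (path_edges (v # ws))"
    then consider "e = {u, v}" | i where "Suc i < length (v # ws)"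
      "e = {(v # ws) ! i, (v # ws) ! Suc i}"
      unfolding path_edges_def by blast
    then show "e \<in> path_edges (u # v # ws)"
    proof cases
      case 1
      then show ?thesis unfolding path_edges_def by (intro CollectI exI[of _ 0]) auto
    next
      case 2
      then show ?thesis unfolding path_edges_def by (intro CollectI exI[of _ "Suc i"]) auto
    qed
  qed
qed

lemma nn_path_simps [simp]:
  "\<not> nn_path []" "nn_path [u]"
  "nn_path (u # v # ws) \<longleftrightarrow> adjacent u v \<and> nn_path (v # ws)"
  by (auto simp: nn_path_def nth_Cons split: nat.splits)

lemma step_parity_xor:
  "(step_parity c ws \<noteq> step_parity c' ws) = step_parity (\<lambda>u v. c u v \<noteq> c' u v) ws"
  by (induction c ws rule: step_parity.induct) auto

lemma step_parity_telescope:
  fixes g :: "vertex \<Rightarrow> bool"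
  shows "ws \<noteq> [] \<Longrightarrow> step_parity (\<lambda>u v. g u \<noteq> g v) ws = (g (hd ws) \<noteq> g (last ws))"
proof (induction ws rule: induct_list012)
  case (3 u v ws)
  have "step_parity (\<lambda>u v. g u \<noteq> g v) (v # ws) = (g v \<noteq> g (last (v # ws)))"
    using "3.IH" by simp
  then show ?case by (simp only: step_parity.simps last.simps list.sel) auto
qed auto

lemma step_parity_cong:
  "nn_path ws \<Longrightarrow> (\<And>u v. u \<in> set ws \<Longrightarrow> v \<in> set ws \<Longrightarrow> adjacent u v \<Longrightarrow> {u, v} \<in> path_edges ws \<Longrightarrow> c u v = c' u v)
     \<Longrightarrow> step_parity c ws = step_parity c' ws"
proof (induction ws rule: induct_list012)
  case (3 u v ws)
  have "step_parity c (v # ws) = step_parity c' (v # ws)"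
    using 3 by (intro "3.IH") auto
  moreover have "c u v = c' u v" using "3.prems" by auto
  ultimately show ?case by simp
qed auto

lemma path_invariant:
  "nn_path ws \<Longrightarrow> (\<And>u v. u \<in> set ws \<Longrightarrow> v \<in> set ws \<Longrightarrow> adjacent u v \<Longrightarrow> {u, v} \<in> path_edges ws \<Longrightarrow> f u = f v)
     \<Longrightarrow> f (hd ws) = f (last ws)"
proof (induction ws rule: induct_list012)
  case (3 u v ws)
  have "f (hd (v # ws)) = f (last (v # ws))"
    using 3 by (intro "3.IH") auto
  moreover have "f u = f v" using "3.prems" by auto
  ultimately show ?case by simp
qed auto

section \<open>Coordinates for edges, and parities of ray crossings\<close>

definition hedge :: "int \<Rightarrow> int \<Rightarrow> edge" where "hedge x y = {(x, y), (x + 1, y)}"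
definition vedge :: "int \<Rightarrow> int \<Rightarrow> edge" where "vedge x y = {(x, y), (x, y + 1)}"

lemma hedge_eq_iff [simp]: "hedge x y = hedge x' y' \<longleftrightarrow> x = x' \<and> y = y'"
  by (auto simp: hedge_def doubleton_eq_iff)

lemma vedge_eq_iff [simp]: "vedge x y = vedge x' y' \<longleftrightarrow> x = x' \<and> y = y'"
  by (auto simp: vedge_def doubleton_eq_iff)

lemma hedge_neq_vedge [simp]: "hedge x y \<noteq> vedge x' y'" "vedge x' y' \<noteq> hedge x y"
  by (auto simp: hedge_def vedge_def doubleton_eq_iff)

lemma adjacent_cases:
  assumes "adjacent u v"
  obtains x y where "u = (x, y)" "v = (x + 1, y)" "{u, v} = hedge x y"
  | x y where "u = (x + 1, y)" "v = (x, y)" "{u, v} = hedge x y"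
  | x y where "u = (x, y)" "v = (x, y + 1)" "{u, v} = vedge x y"
  | x y where "u = (x, y + 1)" "v = (x, y)" "{u, v} = vedge x y"
proof -
  obtain a b c d where uv: "u = (a, b)" "v = (c, d)" by fastforce
  with assms have "\<bar>a - c\<bar> + \<bar>b - d\<bar> = 1" by (simp add: adjacent_def)
  then consider "c = a + 1" "b = d" | "a = c + 1" "b = d" | "a = c" "d = b + 1" | "a = c" "b = d + 1"
    by linarith
  then show ?thesis using uv that
    by cases (auto simp: hedge_def vedge_def insert_commute)
qed

text \<open>The parity with which \<open>ws\<close> crosses the vertical ray going down from the
  dual vertex (Y + 1/2, X - 1/2).\<close>

definition crossings :: "vertex list \<Rightarrow> int \<Rightarrow> int \<Rightarrow> bool" where
  "crossings ws X Y = step_parity (\<lambda>u v. snd u < X \<and> (fst u \<le> Y) \<noteq> (fst v \<le> Y)) ws"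

lemma crossings_low:
  assumes "nn_path ws" "\<forall>w\<in>set ws. X \<le> snd w"
  shows "\<not> crossings ws X Y"
proof -
  have "crossings ws X Y = step_parity (\<lambda>u v. True \<noteq> True) ws"
    unfolding crossings_def using assms by (intro step_parity_cong) force+
  then show ?thesis using step_parity_telescope[of ws "\<lambda>_. True"] assms by (cases ws) auto
qed

lemma crossings_high:
  assumes "nn_path ws" "\<forall>w\<in>set ws. snd w < X" "fst (hd ws) \<le> Y" "Y < fst (last ws)"
  shows "crossings ws X Y"
proof -
  have "crossings ws X Y = step_parity (\<lambda>u v. (fst u \<le> Y) \<noteq> (fst v \<le> Y)) ws"
    unfolding crossings_def using assms by (intro step_parity_cong) auto
  then show ?thesis
    using step_parity_telescope[of ws "\<lambda>u. fst u \<le> Y"] assms by (cases ws) auto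
qed

text \<open>Raising the end of the ray by one makes it cross just one more edge, the excluded
  one.\<close>

lemma crossings_hstep:
  assumes "nn_path ws" "hedge Y X \<notin> path_edges ws"
  shows "crossings ws X Y = crossings ws (X + 1) Y"
  unfolding crossings_def
proof (rule step_parity_cong[OF assms(1)])
  fix u v assume "adjacent u v" "{u, v} \<in> path_edges ws"
  then show "(snd u < X \<and> (fst u \<le> Y) \<noteq> (fst v \<le> Y)) =
    (snd u < X + 1 \<and> (fst u \<le> Y) \<noteq> (fst v \<le> Y))"
    using assms(2) by (cases rule: adjacent_cases; cases "snd u = X"; cases "fst u = Y"; cases "fst v = Y") auto
qed

text \<open>The rays at Y + 1/2 and Y + 3/2 enclose a half-column of vertices whose top is closed
  off by the excluded edge. A path with both ends off the column passes through the two rays an even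
  number of times in total.\<close>

lemma crossings_vstep:
  assumes "nn_path ws" "vedge (Y + 1) (X - 1) \<notin> path_edges ws"
    "fst (hd ws) \<noteq> Y + 1" "fst (last ws) \<noteq> Y + 1"
  shows "crossings ws X Y = crossings ws X (Y + 1)"
proof -
  \<comment> \<open>The indicator of the half-column: a horizontal step changes it iff it crosses
    exactly one of the rays, a vertical step only by using the excluded edge.\<close>
  let ?g = "\<lambda>w::vertex. snd w < X \<and> fst w = Y + 1"
  have "(crossings ws X Y \<noteq> crossings ws X (Y + 1)) = step_parity (\<lambda>u v. ?g u \<noteq> ?g v) ws"
    unfolding crossings_def step_parity_xor
  proof (rule step_parity_cong[OF assms(1)])
    fix u v assume "adjacent u v" "{u, v} \<in> path_edges ws"
    then show "((snd u < X \<and> (fst u \<le> Y) \<noteq> (fst v \<le> Y)) \<noteq>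
      (snd u < X \<and> (fst u \<le> Y + 1) \<noteq> (fst v \<le> Y + 1))) = (?g u \<noteq> ?g v)"
      using assms(2) 
      by (cases rule: adjacent_cases; cases "fst u = Y + 1"; cases "fst v = Y + 1"; cases "snd u = X"; cases "snd v = X") auto
  qed
  also have "\<dots> = (?g (hd ws) \<noteq> ?g (last ws))"
    using assms(1) by (intro step_parity_telescope) auto
  finally show ?thesis using assms(3,4) by auto
qed

text \<open>The ends may lie beyond the columns \<open>p\<close> and \<open>p + k\<close>, so that
  one long path serves as a crossing of every box of its strip without being cut.\<close>

definition strip_crossings :: "int \<Rightarrow> int \<Rightarrow> int \<Rightarrow> vertex list set" where
  "strip_crossings p m k = {ws. nn_path ws \<and> (\<forall>w\<in>set ws. m \<le> snd w \<and> snd w < m + k)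
     \<and> fst (hd ws) \<le> p \<and> p + k \<le> fst (last ws)}"

text \<open>The edges of the square \<open>[p, p + k] \<times> [m, m + k - 1]\<close> without its left and right sides:
  the planar dual of this graph, with top and bottom exchanged for left and right, is a copy of it.\<close>

definition box :: "int \<Rightarrow> int \<Rightarrow> int \<Rightarrow> edge set" where
  "box p m k = {hedge x y | x y. p \<le> x \<and> x < p + k \<and> m \<le> y \<and> y < m + k}
     \<union> {vedge x y | x y. p < x \<and> x < p + k \<and> m \<le> y \<and> y + 1 < m + k}"

lemma hedge_in_box [simp]:
  "hedge x y \<in> box p m k \<longleftrightarrow> p \<le> x \<and> x < p + k \<and> m \<le> y \<and> y < m + k"
  by (auto simp: box_def)

lemma vedge_in_box [simp]:
  "vedge x y \<in> box p m k \<longleftrightarrow> p < x \<and> x < p + k \<and> m \<le> y \<and> y + 1 < m + k"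
  by (auto simp: box_def)

text \<open>Reflecting the dual edge of an edge of the box in the diagonal \<open>x - p = y - m\<close>.\<close>

inductive dual :: "int \<Rightarrow> int \<Rightarrow> edge \<Rightarrow> edge \<Rightarrow> bool" for p m where
  "dual p m (hedge x y) (hedge (p + y - m) (m + x - p))"
| "dual p m (vedge x y) (vedge (p + y - m + 1) (m + x - p - 1))"

lemma path_edge_vertices:
  "{u, v} \<in> path_edges ws \<Longrightarrow> u \<in> set ws \<and> v \<in> set ws"
  by (force simp: path_edges_def doubleton_eq_iff)

text \<open>Up to reflection the second path is a path of the dual lattice crossing the box vertically,
  and \<open>crossings\<close> is the parity with which it meets the horizontal ray to the left of a vertex
  of the first one; this parity differs at the two ends of the first path.\<close>

lemma crossings_meet_dual:
  assumes ws: "ws \<in> strip_crossings p m k" and ws': "ws' \<in> strip_crossings p m k"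
  shows "\<exists>e\<in>path_edges ws \<inter> box p m k. \<exists>e'\<in>path_edges ws' \<inter> box p m k. dual p m e e'"
proof (rule ccontr)
  assume "\<not> ?thesis"
  then have n: False if "e \<in> path_edges ws" "e' \<in> path_edges ws'" "dual p m e e'"
    "e \<in> box p m k" "e' \<in> box p m k" for e e'
    using that by blast
  note s = ws[unfolded strip_crossings_def, simplified]
  note s' = ws'[unfolded strip_crossings_def, simplified]
  \<comment> \<open>The ray attached to a vertex of \<open>ws\<close>, in reflected coordinates. A
    step of \<open>ws\<close> can change the parity only if \<open>ws'\<close> uses the dual
    edge.\<close>
  let ?f = "\<lambda>(x, y). crossings ws' (m + x - p) (p + y - m)"
  have h: "?f (x, y) = ?f (x + 1, y)" if e: "hedge x y \<in> path_edges ws" for x y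
  proof -
    have y: "m \<le> y" "y < m + k"
      using s path_edge_vertices[OF e[unfolded hedge_def]] by auto
    \<comment> \<open>The strip of \<open>ws'\<close> would bound \<open>x\<close> just as the strip
      of \<open>ws\<close> bounds \<open>y\<close>, and both edges would lie in the box.\<close>
    have "hedge (p + y - m) (m + x - p) \<notin> path_edges ws'"
    proof
      assume e': "hedge (p + y - m) (m + x - p) \<in> path_edges ws'"
      then have "m \<le> m + x - p" "m + x - p < m + k"
        using s' path_edge_vertices[OF e'[unfolded hedge_def]] by auto
      then show False using n[OF e e' dual.intros(1)] y by auto
    qed
    from crossings_hstep[OF _ this] s' show ?thesis by (simp add: algebra_simps)
  qed
  have v: "?f (x, y) = ?f (x, y + 1)" if e: "vedge x y \<in> path_edges ws" for x y
  proof -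
    have y: "m \<le> y" "y + 1 < m + k"
      using s path_edge_vertices[OF e[unfolded vedge_def]] by auto
    have "vedge (p + y - m + 1) (m + x - p - 1) \<notin> path_edges ws'"
    proof
      assume e': "vedge (p + y - m + 1) (m + x - p - 1) \<in> path_edges ws'"
      then have "m \<le> m + x - p - 1" "m + x - p < m + k"
        using s' path_edge_vertices[OF e'[unfolded vedge_def]] by auto
      then show False using n[OF e e' dual.intros(2)] y by auto
    qed
    from crossings_vstep[OF _ this] s' y show ?thesis by (simp add: algebra_simps)
  qed
  have "?f (hd ws) = ?f (last ws)"
  proof (rule path_invariant)
    fix u v assume "adjacent u v" "{u, v} \<in> path_edges ws"
    then show "?f u = ?f v"
      using h v by (cases rule: adjacent_cases) auto
  qed (use s in auto)
  \<comment> \<open>At the left end of \<open>ws\<close> the ray stays below the whole of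
    \<open>ws'\<close>; at the right end it reaches above \<open>ws'\<close> and separates the two
    ends of \<open>ws'\<close>.\<close>
  moreover have "\<forall>w\<in>set ws'. m + fst (hd ws) - p \<le> snd w"
    using s s' by (smt (verit))
  then have "\<not> ?f (hd ws)"
    using s' by (simp add: case_prod_unfold crossings_low)
  moreover have "?f (last ws)"
  proof -
    have "ws \<noteq> []" using s by auto
    then have "m \<le> snd (last ws)" "snd (last ws) < m + k" using s last_in_set by blast+
    then show ?thesis
      using s s' by (auto simp: case_prod_unfold intro!: crossings_high)
  qed
  ultimately show False by blast
qed

section \<open>Self-duality of a box and independence of disjoint boxes\<close>

lemma dual_sym: "dual p m e e' \<Longrightarrow> dual p m e' e"
proof (induction rule: dual.induct)
  case (1 x y)
  show ?case using dual.intros(1)[of p m "p + y - m" "m + x - p"] by (simp add: algebra_simps)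
next
  case (2 x y)
  show ?case using dual.intros(2)[of p m "p + y - m + 1" "m + x - p - 1"] by (simp add: algebra_simps)
qed

lemma dual_unique: "dual p m e e' \<Longrightarrow> dual p m e e'' \<Longrightarrow> e' = e''"
  by (auto elim!: dual.cases)

lemma dual_in_box: "dual p m e e' \<Longrightarrow> e \<in> box p m k \<Longrightarrow> e' \<in> box p m k"
  by (auto elim!: dual.cases)

lemma box_has_dual: "e \<in> box p m k \<Longrightarrow> \<exists>e'. dual p m e e'"
  by (auto simp: box_def intro: dual.intros)

lemma box_disjoint: "p + k \<le> p' \<Longrightarrow> box p m k \<inter> box p' m' k' = {}"
  by (auto simp: box_def)

text \<open>Self-duality at 1/2 as an involution on configurations: inside the box the weights
  \<open>a\<close> and \<open>b\<close> are exchanged and carried over to the dual edges.\<close>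

definition dual_flip :: "int \<Rightarrow> int \<Rightarrow> int \<Rightarrow> edge set \<Rightarrow> edge set" where
  "dual_flip p m k B = {e. if e \<in> box p m k then \<exists>e'. dual p m e e' \<and> e' \<notin> B else e \<in> B}"

lemma dual_flip_flip [simp]: "dual_flip p m k (dual_flip p m k B) = B"
proof (intro set_eqI)
  fix e
  show "e \<in> dual_flip p m k (dual_flip p m k B) \<longleftrightarrow> e \<in> B"
  proof (cases "e \<in> box p m k")
    case True
    then obtain e' where e': "dual p m e e'" using box_has_dual by blast
    then have "dual p m e f \<longleftrightarrow> f = e'" "dual p m e' f \<longleftrightarrow> f = e" for f
      using dual_unique dual_sym by blast+
    then show ?thesis
      using True e' dual_in_box[OF e' True] by (simp add: dual_flip_def)
  qed (simp add: dual_flip_def)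
qed

lemma dual_flip_Int:
  "box p m k \<inter> S = {} \<Longrightarrow> S \<inter> dual_flip p m k B = S \<inter> B"
  by (auto simp: dual_flip_def)

lemma dual_flip_subset:
  "B \<subseteq> E \<Longrightarrow> box p m k \<subseteq> E \<Longrightarrow> dual_flip p m k B \<subseteq> E"
  by (auto simp: dual_flip_def split: if_splits)

text \<open>Crossing by \<open>a\<close>-edges. Edges of the path outside the box are unrestricted,
  which makes this an event of the box alone.\<close>

definition crossed :: "int \<Rightarrow> int \<Rightarrow> int \<Rightarrow> edge set \<Rightarrow> bool" where
  "crossed p m k B \<longleftrightarrow> (\<exists>ws\<in>strip_crossings p m k. path_edges ws \<inter> box p m k \<inter> B = {})"

lemma crossed_cong:
  "box p m k \<inter> B = box p m k \<inter> B' \<Longrightarrow> crossed p m k B = crossed p m k B'"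
  by (simp add: crossed_def Int_assoc)

text \<open>The two crossings would contain dual edges \<open>e\<close> and \<open>e'\<close>; if
  \<open>e\<close> is an \<open>a\<close>-edge of \<open>B\<close>, then \<open>e'\<close> is a
  \<open>b\<close>-edge after the flip.\<close>

lemma crossed_not_dual_flip:
  assumes "crossed p m k B" shows "\<not> crossed p m k (dual_flip p m k B)"
proof
  assume "crossed p m k (dual_flip p m k B)"
  with assms obtain ws ws' where ws: "ws \<in> strip_crossings p m k" "path_edges ws \<inter> box p m k \<inter> B = {}"
    and ws': "ws' \<in> strip_crossings p m k" "path_edges ws' \<inter> box p m k \<inter> dual_flip p m k B = {}"
    unfolding crossed_def by blast
  from crossings_meet_dual[OF ws(1) ws'(1)] obtain e e' where
    e: "e \<in> path_edges ws \<inter> box p m k" "e' \<in> path_edges ws' \<inter> box p m k" "dual p m e e'"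
    by blast
  then have "e \<notin> B" "e' \<notin> dual_flip p m k B" using ws ws' by blast+
  then show False using e dual_sym[OF e(3)] by (auto simp: dual_flip_def)
qed

text \<open>Each further box halves the count: flipping it destroys its own crossing and leaves the
  other boxes untouched, so \<open>Y\<close> and its image under the flip are disjoint subsets of
  \<open>X\<close>.\<close>

lemma card_all_crossed_le:
  assumes "finite J" and "finite E" and "\<And>i. i \<in> J \<Longrightarrow> box (p i) m k \<subseteq> E"
    and "\<And>i j. i \<in> J \<Longrightarrow> j \<in> J \<Longrightarrow> i \<noteq> j \<Longrightarrow> box (p i) m k \<inter> box (p j) m k = {}"
  shows "card {B \<in> Pow E. \<forall>i\<in>J. crossed (p i) m k B} * 2 ^ card J \<le> 2 ^ card E"
  using assms
proof (induction J rule: finite_induct)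
  case empty
  then show ?case by (simp add: card_Pow flip: Pow_def)
next
  case (insert j J)
  define X where "X = {B \<in> Pow E. \<forall>i\<in>J. crossed (p i) m k B}"
  define Y where "Y = {B \<in> Pow E. \<forall>i\<in>insert j J. crossed (p i) m k B}"
  let ?f = "dual_flip (p j) m k"
  have fin: "finite X" "finite Y"
    using insert.prems(1) by (auto simp: X_def Y_def)
  have "?f B \<in> X" if B: "B \<in> Y" for B
  proof -
    have "crossed (p i) m k (?f B)" if i: "i \<in> J" for i
    proof -
      have "box (p j) m k \<inter> box (p i) m k = {}"
        using insert.hyps(2) i by (intro insert.prems(3)) auto
      then have "crossed (p i) m k (?f B) = crossed (p i) m k B"
        by (intro crossed_cong dual_flip_Int)
      then show ?thesis using B i by (simp add: Y_def)
    qed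
    moreover have "?f B \<subseteq> E"
      using B insert.prems(2) by (intro dual_flip_subset) (auto simp: Y_def)
    ultimately show ?thesis by (simp add: X_def)
  qed
  then have "Y \<union> ?f ` Y \<subseteq> X" by (auto simp: X_def Y_def)
  then have "card (Y \<union> ?f ` Y) \<le> card X" using fin card_mono by blast
  moreover have "Y \<inter> ?f ` Y = {}"
    using crossed_not_dual_flip by (auto simp: Y_def)
  then have "card (Y \<union> ?f ` Y) = card Y + card (?f ` Y)"
    using fin by (intro card_Un_disjoint) auto
  moreover have "inj_on ?f Y"
    by (rule inj_on_inverseI[where g = ?f]) simp
  then have "card (?f ` Y) = card Y" by (rule card_image)
  ultimately have "2 * card Y \<le> card X" by simp
  then have "card Y * 2 ^ card (insert j J) \<le> card X * 2 ^ card J"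
    using insert.hyps by simp
  also have "\<dots> \<le> 2 ^ card E"
    unfolding X_def using insert.prems by (intro insert.IH) auto
  finally show ?case unfolding Y_def .
qed

lemma finite_path_edges [simp]: "finite (path_edges ws)"
  by (induction ws rule: induct_list012) auto

text \<open>The boxes are grouped into \<open>d\<close> blocks of \<open>g\<close> consecutive ones.
  If every block has an uncrossed box, the path meets a \<open>b\<close>-edge in each block; so
  fewer than \<open>d\<close> of them forces a block of \<open>g\<close> crossed boxes, and a union
  bound over the blocks applies.\<close>

lemma card_few_edges_le:
  fixes d g k :: nat
  assumes E: "finite E" and boxes: "\<And>i. i < d * g \<Longrightarrow> box (int (i * k)) m (int k) \<subseteq> E"
  shows "card {B \<in> Pow E. \<exists>ws. (\<forall>i<d * g. ws \<in> strip_crossings (int (i * k)) m (int k))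
           \<and> card (path_edges ws \<inter> B) < d} * 2 ^ g \<le> d * 2 ^ card E"
proof -
  let ?p = "\<lambda>i. int (i * k)"
  let ?C = "\<lambda>l. {B \<in> Pow E. \<forall>i\<in>{l * g..<l * g + g}. crossed (?p i) m (int k) B}"
  let ?X = "{B \<in> Pow E. \<exists>ws. (\<forall>i<d * g. ws \<in> strip_crossings (?p i) m (int k))
           \<and> card (path_edges ws \<inter> B) < d}"
  have disj: "box (?p i) m (int k) \<inter> box (?p j) m (int k) = {}" if "i \<noteq> j" for i j
  proof -
    have *: "box (?p i) m (int k) \<inter> box (?p j) m (int k) = {}" if "i < j" for i j
    proof (rule box_disjoint)
      have "Suc i * k \<le> j * k" using that by (intro mult_right_mono) auto
      then have "int (Suc i * k) \<le> int (j * k)" by (simp only: of_nat_le_iff)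
      then show "?p i + int k \<le> ?p j" by (simp add: algebra_simps)
    qed
    show ?thesis using that *[of i j] *[of j i] by (cases i j rule: linorder_cases) auto
  qed
  have in_range: "i < d * g" if "l < d" "i \<in> {l * g..<l * g + g}" for i l
  proof -
    have "Suc l * g \<le> d * g" using that by (intro mult_right_mono) auto
    then show ?thesis using that by auto
  qed
  have "?X \<subseteq> (\<Union>l<d. ?C l)"
  proof (rule subsetI, rule ccontr)
    fix B assume B: "B \<in> ?X" and notC: "B \<notin> (\<Union>l<d. ?C l)"
    from B obtain ws where ws: "\<And>i. i < d * g \<Longrightarrow> ws \<in> strip_crossings (?p i) m (int k)"
      and few: "card (path_edges ws \<inter> B) < d" by blast
    have "\<exists>i e. l * g \<le> i \<and> i < l * g + g \<and> e \<in> path_edges ws \<inter> B \<and> e \<in> box (?p i) m (int k)"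
      if "l < d" for l
    proof -
      have "B \<notin> ?C l" using notC that by blast
      then obtain i where i: "i \<in> {l * g..<l * g + g}" "\<not> crossed (?p i) m (int k) B"
        using B by blast
      then show ?thesis
        using ws[OF in_range[OF that i(1)]] by (fastforce simp: crossed_def)
    qed
    then obtain i e where ie: "\<And>l. l < d \<Longrightarrow> l * g \<le> i l \<and> i l < l * g + g \<and>
        e l \<in> path_edges ws \<inter> B \<and> e l \<in> box (?p (i l)) m (int k)" by metis
    have "inj_on e {..<d}"
    proof (rule inj_onI, rule ccontr)
      fix l l' assume l: "l \<in> {..<d}" "l' \<in> {..<d}" "e l = e l'" "l \<noteq> l'"
      \<comment> \<open>The index of the box determines its block, so edges chosen for different
        blocks lie in disjoint boxes.\<close>
      have "i l div g = l" if "l < d" for l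
        using ie[OF that] by (intro div_nat_eqI) (auto simp: mult.commute)
      then have "i l \<noteq> i l'" using l by (metis lessThan_iff)
      with disj ie l show False by (metis IntI emptyE lessThan_iff)
    qed
    then have "d \<le> card (path_edges ws \<inter> B)"
      using card_inj_on_le[of e "{..<d}" "path_edges ws \<inter> B"] ie by auto
    with few show False by simp
  qed
  then have "card ?X \<le> card (\<Union>l<d. ?C l)"
    using E by (intro card_mono) auto
  also have "\<dots> \<le> (\<Sum>l<d. card (?C l))" by (rule card_UN_le) simp
  finally have "card ?X * 2 ^ g \<le> (\<Sum>l<d. card (?C l) * 2 ^ g)"
    by (simp add: sum_distrib_right[symmetric])
  also have "\<dots> \<le> (\<Sum>l<d. 2 ^ card E)"
  proof (rule sum_mono)
    fix l assume l: "l \<in> {..<d}"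
    have "card (?C l) * 2 ^ card {l * g..<l * g + g} \<le> 2 ^ card E"
      using boxes in_range l disj by (intro card_all_crossed_le E) auto
    then show "card (?C l) * 2 ^ g \<le> 2 ^ card E" by simp
  qed
  finally show ?thesis by simp
qed

section \<open>The minimum over a locally overlapping family\<close>

text \<open>The passage time of a path with edge set \<open>\<gamma>\<close> when \<open>B\<close>
  is the set of \<open>b\<close>-edges.\<close>

definition weight :: "real \<Rightarrow> real \<Rightarrow> 'e set \<Rightarrow> 'e set \<Rightarrow> real" where
  "weight a b B \<gamma> = a * real (card \<gamma>) + (b - a) * real (card (\<gamma> \<inter> B))"

lemma weight_remove:
  assumes "finite \<gamma>" "e \<in> \<gamma> \<inter> B"
  shows "weight a b (B - {e}) \<gamma> = weight a b B \<gamma> - (b - a)"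
proof -
  have "\<gamma> \<inter> (B - {e}) = \<gamma> \<inter> B - {e}" by auto
  then have "card (\<gamma> \<inter> B) = Suc (card (\<gamma> \<inter> (B - {e})))"
    using assms card.remove[of "\<gamma> \<inter> B" e] by simp
  then show ?thesis by (simp add: weight_def algebra_simps)
qed

lemma weight_remove_irrelevant:
  "e \<notin> \<gamma> \<Longrightarrow> weight a b (B - {e}) \<gamma> = weight a b B \<gamma>"
proof -
  assume "e \<notin> \<gamma>"
  then have "\<gamma> \<inter> (B - {e}) = \<gamma> \<inter> B" by auto
  then show ?thesis by (simp add: weight_def)
qed

text \<open>Abstract form of the main argument: \<open>R m\<close> is the edge set of strip
  \<open>m\<close>, \<open>P m\<close> its paths, \<open>N\<close> bounds its size and
  \<open>K\<close> the number of strips meeting a given one; in \<open>S\<close> every path has at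
  least \<open>d\<close> edges of weight \<open>b\<close>. The interval has length
  \<open>b - a\<close>, the drop caused by lowering one edge. The exponential term is a Chernoff
  bound for discrepancies above \<open>t\<close>.\<close>

lemma card_min_weight_in_interval_le:
  fixes E :: "'e set" and I :: "'i set" and R :: "'i \<Rightarrow> 'e set" and P :: "'i \<Rightarrow> 'e set set"
    and a b l t x :: real and N K d :: nat
  assumes ab: "a < b" and E: "finite E" and I: "finite I"
    and R: "\<And>m. m \<in> I \<Longrightarrow> R m \<subseteq> E" and N: "\<And>m. m \<in> I \<Longrightarrow> card (R m) \<le> N"
    and P: "\<And>m \<gamma>. m \<in> I \<Longrightarrow> \<gamma> \<in> P m \<Longrightarrow> \<gamma> \<subseteq> R m"
    and K: "\<And>m'. m' \<in> I \<Longrightarrow> card {m \<in> I. R m' \<inter> R m \<noteq> {}} \<le> K"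
    and l: "0 < l" "l \<le> 1" and t: "0 \<le> t"
    and S: "S \<subseteq> Pow E" and d: "\<And>B m \<gamma>. B \<in> S \<Longrightarrow> m \<in> I \<Longrightarrow> \<gamma> \<in> P m \<Longrightarrow> d \<le> card (\<gamma> \<inter> B)"
  shows "real d * real (card {B \<in> S. (\<forall>m\<in>I. \<forall>\<gamma>\<in>P m. x \<le> weight a b B \<gamma>)
             \<and> (\<exists>m\<in>I. \<exists>\<gamma>\<in>P m. weight a b B \<gamma> < x + (b - a))})
          \<le> 2 ^ card E * (real K * t + real (card I) * (exp (l^2 * real N - l * t) / l))"
proof -
  define A where "A m = {B \<in> S. (\<forall>m\<in>I. \<forall>\<gamma>\<in>P m. x \<le> weight a b B \<gamma>)
             \<and> (\<exists>\<gamma>\<in>P m. weight a b B \<gamma> < x + (b - a))}" for m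
  define G where "G m = {B \<in> Pow E. (\<exists>m\<in>I. \<exists>\<gamma>\<in>P m. weight a b B \<gamma> < x)
             \<and> (\<forall>m'\<in>I. \<forall>\<gamma>\<in>P m'. weight a b B \<gamma> < x \<longrightarrow> \<gamma> \<inter> R m \<noteq> {})}" for m
  define D where "D m B = real (card (R m - B)) - real (card (R m \<inter> B))" for m B
  define \<epsilon> where "\<epsilon> = exp (l^2 * real N - l * t) / l"
  have finP: "finite \<gamma>" if "m \<in> I" "\<gamma> \<in> P m" for m \<gamma>
    using finite_subset[OF order_trans[OF P[OF that] R[OF that(1)]] E] .
  have finG: "finite (G m)" for m using E by (simp add: G_def)
  have boundary: "real d * real (card (A m)) \<le> (\<Sum>B\<in>G m. D m B)" if m: "m \<in> I" for m
    unfolding D_def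
  proof (rule edge_boundary_le[OF E R[OF m]])
    show "G m \<subseteq> Pow E" "A m \<subseteq> Pow E" using S by (auto simp: G_def A_def)
    show "A m \<inter> G m = {}" by (force simp: G_def A_def)
  next
    fix B e assume B: "B \<in> G m" and e: "e \<in> R m \<inter> B"
    have le: "weight a b (B - {e}) \<gamma> \<le> weight a b B \<gamma>" if "m' \<in> I" "\<gamma> \<in> P m'" for m' \<gamma>
    proof (cases "e \<in> \<gamma>")
      case True
      then show ?thesis using weight_remove[of \<gamma> e B a b] finP[OF that] e ab by simp
    qed (simp add: weight_remove_irrelevant)
    \<comment> \<open>A path that becomes faster than \<open>x\<close> by lowering \<open>e\<close>
      contains \<open>e\<close>, an edge of \<open>R m\<close>.\<close>
    have "\<gamma> \<inter> R m \<noteq> {}" if "m' \<in> I" "\<gamma> \<in> P m'" "weight a b (B - {e}) \<gamma> < x" for m' \<gamma>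
    proof (cases "e \<in> \<gamma>")
      case False
      then show ?thesis using that B by (simp add: weight_remove_irrelevant G_def)
    qed (use e in auto)
    then show "B - {e} \<in> G m"
      using B le by (fastforce simp: G_def intro: le_less_trans)
  next
    fix B assume B: "B \<in> A m"
    then obtain \<gamma> where \<gamma>: "\<gamma> \<in> P m" "weight a b B \<gamma> < x + (b - a)" and BS: "B \<in> S"
      by (auto simp: A_def)
    have BE: "B \<subseteq> E" using BS S by auto
    \<comment> \<open>Lowering \<open>e\<close> takes \<open>\<gamma>\<close> below
      \<open>x\<close>. No path was below \<open>x\<close> before, so every fast path now contains
      \<open>e\<close> and meets the strip.\<close>
    have "B - {e} \<in> G m" if e: "e \<in> \<gamma> \<inter> B" for e
    proof -
      have "weight a b (B - {e}) \<gamma> < x"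
        using weight_remove[OF finP[OF m \<gamma>(1)] e] \<gamma>(2) by simp
      moreover have "\<gamma>' \<inter> R m \<noteq> {}" if "m' \<in> I" "\<gamma>' \<in> P m'" "weight a b (B - {e}) \<gamma>' < x" for m' \<gamma>'
      proof -
        have "x \<le> weight a b B \<gamma>'" using B that by (auto simp: A_def)
        then have "e \<in> \<gamma>'" using that weight_remove_irrelevant by fastforce
        then show ?thesis using e P[OF m \<gamma>(1)] by auto
      qed
      ultimately show ?thesis using m \<gamma>(1) BE by (auto simp: G_def)
    qed
    then have "\<gamma> \<inter> B \<subseteq> {e \<in> R m \<inter> B. B - {e} \<in> G m}"
      using P[OF m \<gamma>(1)] by auto
    moreover have "finite {e \<in> R m \<inter> B. B - {e} \<in> G m}"
      using R[OF m] E finite_subset by fastforce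
    ultimately show "d \<le> card {e \<in> R m \<inter> B. B - {e} \<in> G m}"
      using d[OF BS m \<gamma>(1)] card_mono order_trans by blast
  qed
  have tail: "(\<Sum>B\<in>G m. D m B) \<le> t * real (card (G m)) + 2 ^ card E * \<epsilon>" if m: "m \<in> I" for m
  proof -
    \<comment> \<open>From u \<le> exp u with u = l (D - t): the part of the discrepancy above
      \<open>t\<close> is controlled by its exponential moment.\<close>
    have "D m B \<le> t + exp (- (l * t)) / l * exp (l * D m B)" for B
    proof -
      have "l * (D m B - t) \<le> exp (l * (D m B - t))"
        using exp_ge_add_one_self[of "l * (D m B - t)"] by linarith
      then have "D m B - t \<le> exp (l * (D m B - t)) / l"
        using l by (simp add: field_simps)
      also have "\<dots> = exp (- (l * t)) / l * exp (l * D m B)"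
        by (simp add: right_diff_distrib exp_diff exp_minus field_simps)
      finally show ?thesis by simp
    qed
    then have "(\<Sum>B\<in>G m. D m B) \<le> (\<Sum>B\<in>G m. t + exp (- (l * t)) / l * exp (l * D m B))"
      by (rule sum_mono)
    also have "\<dots> = t * real (card (G m)) + exp (- (l * t)) / l * (\<Sum>B\<in>G m. exp (l * D m B))"
      by (simp add: sum.distrib sum_distrib_left)
    also have "(\<Sum>B\<in>G m. exp (l * D m B)) \<le> (\<Sum>B\<in>Pow E. exp (l * D m B))"
      using E by (intro sum_mono2) (auto simp: G_def)
    also have "\<dots> \<le> 2 ^ card E * exp (l^2 * real N)"
      unfolding D_def using l by (intro sum_exp_discrepancy_le E R[OF m] N[OF m]) auto
    finally have "(\<Sum>B\<in>G m. D m B) \<le> t * real (card (G m))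
        + exp (- (l * t)) / l * (2 ^ card E * exp (l^2 * real N))"
      using l by (simp add: mult_left_mono divide_right_mono)
    also have "exp (- (l * t)) / l * (2 ^ card E * exp (l^2 * real N)) = 2 ^ card E * \<epsilon>"
      by (simp add: \<epsilon>_def exp_diff exp_minus field_simps)
    finally show ?thesis .
  qed
  have mult: "(\<Sum>m\<in>I. card (G m)) \<le> K * 2 ^ card E"
  proof -
    \<comment> \<open>One fast path of \<open>B\<close>, in strip \<open>m'\<close>, has to meet
      \<open>R m\<close> for every \<open>m\<close> with \<open>B\<close> in
      \<open>G m\<close>.\<close>
    have "card {m \<in> I. B \<in> G m} \<le> K" if "B \<in> Pow E" for B
    proof (cases "\<exists>m\<in>I. \<exists>\<gamma>\<in>P m. weight a b B \<gamma> < x")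
      case True
      then obtain m' \<gamma> where m': "m' \<in> I" "\<gamma> \<in> P m'" "weight a b B \<gamma> < x" by blast
      then have "{m \<in> I. B \<in> G m} \<subseteq> {m \<in> I. R m' \<inter> R m \<noteq> {}}"
        using P[OF m'(1,2)] by (fastforce simp: G_def)
      then have "card {m \<in> I. B \<in> G m} \<le> card {m \<in> I. R m' \<inter> R m \<noteq> {}}"
        using I by (intro card_mono) auto
      then show ?thesis using K[OF m'(1)] by simp
    next
      case False
      then have "{m \<in> I. B \<in> G m} = {}" by (auto simp: G_def)
      then show ?thesis by (simp only: card.empty)
    qed
    then have "(\<Sum>B\<in>Pow E. card {m \<in> I. B \<in> G m}) \<le> (\<Sum>B\<in>Pow E. K)" by (rule sum_mono)
    also have "(\<Sum>B\<in>Pow E. card {m \<in> I. B \<in> G m}) = (\<Sum>m\<in>I. card {B \<in> Pow E. B \<in> G m})"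
      using sum.swap_restrict[of "Pow E" I "\<lambda>_ _. 1::nat" "\<lambda>B m. B \<in> G m"] E I by simp
    also have "\<dots> = (\<Sum>m\<in>I. card (G m))"
      by (intro sum.cong refl arg_cong[where f = card]) (auto simp: G_def)
    finally show ?thesis using E by (simp add: card_Pow mult.commute)
  qed
  have "{B \<in> S. (\<forall>m\<in>I. \<forall>\<gamma>\<in>P m. x \<le> weight a b B \<gamma>)
             \<and> (\<exists>m\<in>I. \<exists>\<gamma>\<in>P m. weight a b B \<gamma> < x + (b - a))} = (\<Union>m\<in>I. A m)"
    by (auto simp: A_def)
  then have "real d * real (card {B \<in> S. (\<forall>m\<in>I. \<forall>\<gamma>\<in>P m. x \<le> weight a b B \<gamma>)
             \<and> (\<exists>m\<in>I. \<exists>\<gamma>\<in>P m. weight a b B \<gamma> < x + (b - a))})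
      \<le> real d * real (\<Sum>m\<in>I. card (A m))"
    using card_UN_le[OF I, of A] by (intro mult_left_mono of_nat_mono) auto
  also have "\<dots> = (\<Sum>m\<in>I. real d * real (card (A m)))" by (simp add: sum_distrib_left)
  also have "\<dots> \<le> (\<Sum>m\<in>I. t * real (card (G m)) + 2 ^ card E * \<epsilon>)"
    using boundary tail by (intro sum_mono) (meson order_trans)
  also have "\<dots> = t * real (\<Sum>m\<in>I. card (G m)) + real (card I) * (2 ^ card E * \<epsilon>)"
    by (simp add: sum.distrib sum_distrib_left)
  also have "\<dots> \<le> t * real (K * 2 ^ card E) + real (card I) * (2 ^ card E * \<epsilon>)"
    using mult t by (intro add_right_mono mult_left_mono of_nat_mono) auto
  finally show ?thesis by (simp add: \<epsilon>_def algebra_simps)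
qed

section \<open>Strips of the lattice\<close>

lemma measure_weight_space_le:
  assumes ab: "a < b" and E: "finite E" "E \<subseteq> lattice_edges" and X: "X \<subseteq> Pow E"
    and A: "A \<subseteq> space (weight_space a b)"
    and AX: "\<And>\<omega> B. \<omega> \<in> A \<Longrightarrow> B \<subseteq> E \<Longrightarrow> \<forall>e\<in>E. \<omega> e = (if e \<in> B then b else a) \<Longrightarrow> B \<in> X"
  shows "measure (weight_space a b) A \<le> real (card X) / 2 ^ card E"
proof -
  let ?p = "measure_pmf (pmf_of_set {a, b})"
  let ?M = "weight_space a b"
  interpret product_prob_space "\<lambda>_::edge. ?p" lattice_edges
    by unfold_locales
  interpret W: prob_space ?M
    unfolding weight_space_def by (rule prob_space_axioms)
  define cyl where "cyl B = prod_emb lattice_edges (\<lambda>_. ?p) E (Pi\<^sub>E E (\<lambda>e. {if e \<in> B then b else a}))" for B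
  have cyl: "cyl B \<in> sets ?M" for B
    unfolding cyl_def weight_space_def using E by (intro sets_PiM_I) auto
  have half: "emeasure ?p {if e \<in> B then b else a} = ennreal (1/2)" for e :: edge and B
    using ab by (simp add: emeasure_pmf_single)
  have m_cyl: "measure ?M (cyl B) = (1/2) ^ card E" for B
  proof -
    have "emeasure ?M (cyl B) = (\<Prod>e\<in>E. emeasure ?p {if e \<in> B then b else a})"
      unfolding cyl_def weight_space_def using E by (intro emeasure_PiM_emb) auto
    also have "\<dots> = ennreal ((1/2) ^ card E)"
      by (simp only: half prod_constant ennreal_power)
    finally show ?thesis by (simp add: measure_def)
  qed
  have mem: "\<omega> \<in> cyl B \<longleftrightarrow> \<omega> \<in> space ?M \<and> (\<forall>e\<in>E. \<omega> e = (if e \<in> B then b else a))" for \<omega> B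
    using E by (auto simp: cyl_def prod_emb_def weight_space_def space_PiM PiE_iff restrict_def extensional_def)
  have disj: "disjoint_family_on cyl (Pow E - X)"
    unfolding disjoint_family_on_def
  proof (intro ballI impI)
    fix B B' assume B: "B \<in> Pow E - X" "B' \<in> Pow E - X" "B \<noteq> B'"
    then obtain e where "e \<in> E" "e \<in> B \<longleftrightarrow> e \<notin> B'" by blast
    then show "cyl B \<inter> cyl B' = {}" using ab by (fastforce simp: mem split: if_splits)
  qed
  \<comment> \<open>The space also contains outcomes with weights other than \<open>a\<close> and
    \<open>b\<close>, a null set. Removing the cylinders over the complement of \<open>X\<close>
    keeps these outcomes, whereas the cylinders over \<open>X\<close> would not cover them.\<close>
  have "A \<subseteq> space ?M - (\<Union>B\<in>Pow E - X. cyl B)"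
    using A AX by (auto simp: mem)
  then have "measure ?M A \<le> measure ?M (space ?M - (\<Union>B\<in>Pow E - X. cyl B))"
    using E cyl by (intro W.finite_measure_mono sets.compl_sets sets.finite_UN) auto
  also have "\<dots> = 1 - measure ?M (\<Union>B\<in>Pow E - X. cyl B)"
    using E cyl by (intro W.prob_compl) auto
  also have "measure ?M (\<Union>B\<in>Pow E - X. cyl B) = (\<Sum>B\<in>Pow E - X. measure ?M (cyl B))"
    using E cyl disj by (intro W.finite_measure_finite_Union) auto
  also have "\<dots> = real (card (Pow E - X)) / 2 ^ card E"
    by (simp add: m_cyl power_one_over)
  also have "real (card (Pow E - X)) = 2 ^ card E - real (card X)"
    using E X by (simp add: card_Diff_subset finite_subset[OF X] card_Pow of_nat_diff card_mono flip: card_Pow)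
  finally show ?thesis by (simp add: diff_divide_distrib)
qed

definition strip :: "nat \<Rightarrow> nat \<Rightarrow> int \<Rightarrow> edge set" where
  "strip n k m = {hedge x y | x y. 0 \<le> x \<and> x < int n \<and> m \<le> y \<and> y < m + int k}
     \<union> {vedge x y | x y. 0 \<le> x \<and> x \<le> int n \<and> m \<le> y \<and> y + 1 < m + int k}"

lemma strip_as_image:
  "strip n k m = (\<lambda>(x, y). hedge x y) ` ({0..<int n} \<times> {m..<m + int k})
     \<union> (\<lambda>(x, y). vedge x y) ` ({0..<int n + 1} \<times> {m..<m + int k - 1})"
  by (auto simp: strip_def)

lemma finite_strip [simp]: "finite (strip n k m)"
  by (simp add: strip_as_image)

lemma card_strip_le:
  assumes "1 \<le> n" shows "card (strip n k m) \<le> 3 * n * k"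
proof -
  have "card (strip n k m) \<le> card ({0..<int n} \<times> {m..<m + int k})
      + card ({0..<int n + 1} \<times> {m..<m + int k - 1})"
    unfolding strip_as_image
    by (intro order_trans[OF card_Un_le] add_mono card_image_le) auto
  also have "\<dots> = n * k + (n + 1) * (k - 1)"
    by (simp add: card_cartesian_product nat_diff_distrib' nat_add_distrib)
  also have "\<dots> \<le> n * k + (n + n) * k"
    using assms by (intro add_left_mono mult_le_mono) auto
  finally show ?thesis by (simp add: algebra_simps)
qed

lemma strip_lattice_edges: "strip n k m \<subseteq> lattice_edges"
proof -
  have "adjacent (x, y) (x + 1, y)" "adjacent (x, y) (x, y + 1)" for x y
    by (auto simp: adjacent_def)
  then show ?thesis
    by (fastforce simp: strip_def lattice_edges_def hedge_def vedge_def)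
qed

lemma strip_meet: "strip n k m \<inter> strip n k m' \<noteq> {} \<Longrightarrow> m - int k < m' \<and> m' < m + int k"
  by (auto simp: strip_def)

text \<open>Strips are not clipped to the square, so their boxes are complete and self-dual even for
  the extreme values of \<open>m\<close>.\<close>

lemma box_subset_strip:
  "0 \<le> p \<Longrightarrow> p + int k \<le> int n \<Longrightarrow> box p m (int k) \<subseteq> strip n k m"
  by (auto simp: strip_def box_def)

text \<open>Edge sets suffice, because \<open>passage_time\<close> counts a repeated edge
  once.\<close>

definition strip_paths :: "nat \<Rightarrow> nat \<Rightarrow> int \<Rightarrow> edge set set" where
  "strip_paths n k m = path_edges ` {xs \<in> paths_k n k. \<forall>v\<in>set xs. m \<le> snd v \<and> snd v < m + int k}"

lemma strip_paths_subset:
  assumes "\<gamma> \<in> strip_paths n k m" shows "\<gamma> \<subseteq> strip n k m"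
proof
  fix e assume "e \<in> \<gamma>"
  with assms obtain xs where xs: "xs \<in> paths_k n k" "\<forall>v\<in>set xs. m \<le> snd v \<and> snd v < m + int k"
    and e: "e \<in> path_edges xs" by (auto simp: strip_paths_def)
  from e obtain i where i: "Suc i < length xs" "e = {xs ! i, xs ! Suc i}"
    by (auto simp: path_edges_def)
  then have "xs ! i \<in> set xs" "xs ! Suc i \<in> set xs" by auto
  with xs have v: "0 \<le> fst v" "fst v \<le> int n" "m \<le> snd v" "snd v < m + int k"
    if "v = xs ! i \<or> v = xs ! Suc i" for v
    using that by (auto simp: paths_k_def)
  have "adjacent (xs ! i) (xs ! Suc i)"
    using xs(1) i(1) by (auto simp: paths_k_def nn_path_def)
  then show "e \<in> strip n k m"
    using v[of "xs ! i"] v[of "xs ! Suc i"]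
    by (cases rule: adjacent_cases) (auto simp: i(2) strip_def)
qed

lemma paths_k_strip:
  assumes "xs \<in> paths_k n k"
  obtains m where "m \<in> {- int k<..<int n}" "path_edges xs \<in> strip_paths n k m"
proof -
  from assms obtain m where m: "\<forall>v\<in>set xs. m \<le> snd v \<and> snd v \<le> m + int k - 1"
    and ne: "xs \<noteq> []" and r: "\<forall>v\<in>set xs. 0 \<le> snd v \<and> snd v \<le> int n - 1"
    by (auto simp: paths_k_def nn_path_def)
  have "hd xs \<in> set xs" using ne by simp
  \<comment> \<open>The height of the first vertex lies both in 0, ..., n - 1 and in m, ..., m + k -
    1.\<close>
  then have "m \<in> {- int k<..<int n}" using m r by fastforce
  moreover have "path_edges xs \<in> strip_paths n k m"
    using assms m by (force simp: strip_paths_def)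
  ultimately show ?thesis using that by blast
qed

text \<open>Keeps the infimum in \<open>tau\<close> from being taken over the empty set; the witness
  is the straight path at height 0.\<close>

lemma paths_k_nonempty:
  assumes "1 \<le> n" "1 \<le> k" shows "paths_k n k \<noteq> {}"
proof -
  let ?xs = "map (\<lambda>i. (int i, 0)) [0..<Suc n] :: vertex list"
  have "nn_path ?xs"
    by (auto simp: nn_path_def adjacent_def nth_append simp del: upt_Suc)
  moreover have "fst (hd ?xs) = 0"
    by (simp add: hd_map del: upt_Suc)
  moreover have "fst (last ?xs) = int n"
    by simp
  moreover have "\<forall>v\<in>set ?xs. 0 \<le> fst v \<and> fst v \<le> int n \<and> snd v = 0"
    by auto
  ultimately have "?xs \<in> paths_k n k"
    using assms unfolding paths_k_def by fastforce
  then show ?thesis by blast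
qed

lemma strip_paths_crossings:
  assumes "\<gamma> \<in> strip_paths n k m"
  obtains ws where "\<gamma> = path_edges ws"
    "\<And>p. 0 \<le> p \<Longrightarrow> p + int k \<le> int n \<Longrightarrow> ws \<in> strip_crossings p m (int k)"
  using assms that by (auto simp: strip_paths_def paths_k_def strip_crossings_def)

section \<open>The passage time as a function of finitely many edges\<close>

definition strips_edges :: "nat \<Rightarrow> nat \<Rightarrow> edge set" where
  "strips_edges n k = (\<Union>m\<in>{- int k<..<int n}. strip n k m)"

lemma finite_strips_edges [simp]: "finite (strips_edges n k)"
  by (simp add: strips_edges_def)

text \<open>Paths may revisit vertices, so there are infinitely many, but their passage times depend
  on subsets of a finite edge set and take finitely many values. Hence the infimum is a
  minimum.\<close>

lemma tau_attained:
  assumes "1 \<le> n" "1 \<le> k" and B: "B \<subseteq> strips_edges n k"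
    and \<omega>: "\<forall>e\<in>strips_edges n k. \<omega> e = (if e \<in> B then b else a)"
  shows "\<And>m \<gamma>. m \<in> {- int k<..<int n} \<Longrightarrow> \<gamma> \<in> strip_paths n k m \<Longrightarrow> tau n k \<omega> \<le> weight a b B \<gamma>"
    and "\<exists>m\<in>{- int k<..<int n}. \<exists>\<gamma>\<in>strip_paths n k m. weight a b B \<gamma> = tau n k \<omega>"
proof -
  have sub: "\<gamma> \<subseteq> strips_edges n k" if "m \<in> {- int k<..<int n}" "\<gamma> \<in> strip_paths n k m" for m \<gamma>
    using strip_paths_subset[OF that(2)] that(1) by (auto simp: strips_edges_def)
  have sub': "path_edges xs \<subseteq> strips_edges n k" if "xs \<in> paths_k n k" for xs
    using paths_k_strip[OF that] sub by metis
  have pt: "passage_time \<omega> xs = weight a b B (path_edges xs)" if "path_edges xs \<subseteq> strips_edges n k" for xs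
  proof -
    have "passage_time \<omega> xs = (\<Sum>e\<in>path_edges xs. a + (if e \<in> B then b - a else 0))"
      unfolding passage_time_def using that \<omega> by (intro sum.cong) auto
    then show ?thesis
      by (simp add: sum.distrib weight_def sum.If_cases mult.commute)
  qed
  let ?T = "passage_time \<omega> ` paths_k n k"
  have "?T \<subseteq> weight a b B ` Pow (strips_edges n k)"
    using pt sub' by fastforce
  then have fin: "finite ?T" by (rule finite_subset) simp
  have ne: "?T \<noteq> {}" using paths_k_nonempty assms by simp
  have tau: "tau n k \<omega> = Min ?T"
    unfolding tau_def using fin ne by (rule cInf_eq_Min)
  show "tau n k \<omega> \<le> weight a b B \<gamma>" if "m \<in> {- int k<..<int n}" "\<gamma> \<in> strip_paths n k m" for m \<gamma>
  proof -
    from that(2) obtain xs where "xs \<in> paths_k n k" "\<gamma> = path_edges xs"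
      by (auto simp: strip_paths_def)
    then show ?thesis using tau fin pt[OF sub'] by (metis Min_le imageI)
  qed
  have "Min ?T \<in> ?T" using fin ne by (rule Min_in)
  then obtain xs where xs: "xs \<in> paths_k n k" "tau n k \<omega> = passage_time \<omega> xs"
    using tau by auto
  then show "\<exists>m\<in>{- int k<..<int n}. \<exists>\<gamma>\<in>strip_paths n k m. weight a b B \<gamma> = tau n k \<omega>"
    using paths_k_strip[OF xs(1)] pt[OF sub'] by metis
qed

text \<open>The first term is a union bound over the strips for a path with fewer than
  \<open>d\<close> edges of weight \<open>b\<close>. The second applies
  \<open>card_min_weight_in_interval_le\<close>, with strips of at most \<open>3 * n * k\<close>
  edges and overlap \<open>2 * k\<close>, to each interval of a cover of [x, x + c].\<close>

lemma tau_anticoncentration: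
  fixes n k d g :: nat and a b c l t x :: real
  assumes ab: "a < b" and c: "0 < c" and nk: "1 \<le> n" "1 \<le> k" and d: "1 \<le> d" and dgk: "d * g * k \<le> n"
    and l: "0 < l" "l \<le> 1" and t: "0 \<le> t"
  shows "measure (weight_space a b) {\<omega> \<in> space (weight_space a b). tau n k \<omega> \<in> {x..x + c}}
    \<le> real (n + k) * (real d / 2 ^ g) + real (nat \<lfloor>c / (b - a)\<rfloor> + 1) *
        ((real (2 * k) * t + real (n + k) * (exp (l^2 * real (3 * n * k) - l * t) / l)) / real d)"
proof -
  let ?I = "{- int k<..<int n}"
  let ?E = "strips_edges n k"
  let ?P = "strip_paths n k"
  let ?w = "weight a b"
  define \<delta> where "\<delta> = b - a"
  \<comment> \<open>This many half-open intervals of length \<open>\<delta>\<close>, starting at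
    \<open>x\<close>, cover [x, x + c] including its right end.\<close>
  define Q where "Q = nat \<lfloor>c / \<delta>\<rfloor> + 1"
  define bad where "bad = (\<Union>m\<in>?I. {B \<in> Pow ?E. \<exists>\<gamma>\<in>?P m. card (\<gamma> \<inter> B) < d})"
  define near where "near y = {B \<in> Pow ?E - bad. (\<forall>m\<in>?I. \<forall>\<gamma>\<in>?P m. y \<le> ?w B \<gamma>)
    \<and> (\<exists>m\<in>?I. \<exists>\<gamma>\<in>?P m. ?w B \<gamma> < y + (b - a))}" for y
  define \<Delta> where "\<Delta> = real (2 * k) * t + real (n + k) * (exp (l^2 * real (3 * n * k) - l * t) / l)"
  have \<delta>: "0 < \<delta>" using ab by (simp add: \<delta>_def)
  have cardI: "card ?I \<le> n + k" by simp
  have bad_card: "real (card bad) \<le> real (n + k) * (real d / 2 ^ g) * 2 ^ card ?E"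
  proof -
    have "real (card {B \<in> Pow ?E. \<exists>\<gamma>\<in>?P m. card (\<gamma> \<inter> B) < d}) \<le> real d / 2 ^ g * 2 ^ card ?E"
      if m: "m \<in> ?I" for m
    proof -
      \<comment> \<open>The \<open>d * g\<close> boxes of width \<open>k\<close> side by side fit
        into width \<open>n\<close>.\<close>
      have range: "int (i * k) + int k \<le> int n" if "i < d * g" for i
      proof -
        have "Suc i * k \<le> d * g * k" using that by (intro mult_right_mono) auto
        then have "int (Suc i * k) \<le> int n" using dgk by (simp only: of_nat_le_iff)
        then show ?thesis by (simp add: algebra_simps)
      qed
      let ?Y = "{B \<in> Pow ?E. \<exists>ws. (\<forall>i<d * g. ws \<in> strip_crossings (int (i * k)) m (int k))
           \<and> card (path_edges ws \<inter> B) < d}"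
      have "{B \<in> Pow ?E. \<exists>\<gamma>\<in>?P m. card (\<gamma> \<inter> B) < d} \<subseteq> ?Y"
      proof safe
        fix B \<gamma> assume \<gamma>: "\<gamma> \<in> ?P m" "card (\<gamma> \<inter> B) < d"
        from strip_paths_crossings[OF \<gamma>(1)] obtain ws where "\<gamma> = path_edges ws"
          "\<And>p. 0 \<le> p \<Longrightarrow> p + int k \<le> int n \<Longrightarrow> ws \<in> strip_crossings p m (int k)" by blast
        then show "\<exists>ws. (\<forall>i<d * g. ws \<in> strip_crossings (int (i * k)) m (int k))
           \<and> card (path_edges ws \<inter> B) < d"
          using \<gamma>(2) range by (intro exI[of _ ws]) auto
      qed
      then have "card {B \<in> Pow ?E. \<exists>\<gamma>\<in>?P m. card (\<gamma> \<inter> B) < d} \<le> card ?Y"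
        by (intro card_mono) auto
      moreover have "card ?Y * 2 ^ g \<le> d * 2 ^ card ?E"
      proof (rule card_few_edges_le)
        fix i assume "i < d * g"
        then show "box (int (i * k)) m (int k) \<subseteq> ?E"
          using box_subset_strip[of "int (i * k)" k n m] range m by (force simp: strips_edges_def)
      qed (use nk in auto)
      ultimately have "card {B \<in> Pow ?E. \<exists>\<gamma>\<in>?P m. card (\<gamma> \<inter> B) < d} * 2 ^ g \<le> d * 2 ^ card ?E"
        using mult_le_mono1 order_trans by blast
      then have "real (card {B \<in> Pow ?E. \<exists>\<gamma>\<in>?P m. card (\<gamma> \<inter> B) < d} * 2 ^ g) \<le> real (d * 2 ^ card ?E)"
        by (simp only: of_nat_le_iff)
      then show ?thesis by (simp add: field_simps)
    qed
    then have "real (\<Sum>m\<in>?I. card {B \<in> Pow ?E. \<exists>\<gamma>\<in>?P m. card (\<gamma> \<inter> B) < d})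
        \<le> real (card ?I) * (real d / 2 ^ g * 2 ^ card ?E)"
      unfolding of_nat_sum by (rule sum_bounded_above)
    also have "\<dots> \<le> real (n + k) * (real d / 2 ^ g * 2 ^ card ?E)"
      using cardI by (intro mult_right_mono of_nat_mono) auto
    finally have "real (\<Sum>m\<in>?I. card {B \<in> Pow ?E. \<exists>\<gamma>\<in>?P m. card (\<gamma> \<inter> B) < d})
      \<le> real (n + k) * (real d / 2 ^ g) * 2 ^ card ?E" by (simp only: mult.assoc)
    moreover have "card bad \<le> (\<Sum>m\<in>?I. card {B \<in> Pow ?E. \<exists>\<gamma>\<in>?P m. card (\<gamma> \<inter> B) < d})"
      unfolding bad_def by (rule card_UN_le) simp
    ultimately show ?thesis using of_nat_mono order_trans by blast
  qed
  have near_card: "real (card (near y)) \<le> \<Delta> / real d * 2 ^ card ?E" for y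
  proof -
    have "real d * real (card (near y)) \<le> 2 ^ card ?E *
        (real (2 * k) * t + real (card ?I) * (exp (l^2 * real (3 * n * k) - l * t) / l))"
      unfolding near_def
    proof (rule card_min_weight_in_interval_le[OF ab, where R = "strip n k"])
      show "card {m \<in> ?I. strip n k m' \<inter> strip n k m \<noteq> {}} \<le> 2 * k" for m'
      proof -
        have "{m \<in> ?I. strip n k m' \<inter> strip n k m \<noteq> {}} \<subseteq> {m' - int k<..<m' + int k}"
          using strip_meet[of n k m'] by (intro subsetI) simp
        then have "card {m \<in> ?I. strip n k m' \<inter> strip n k m \<noteq> {}} \<le> card {m' - int k<..<m' + int k}"
          by (intro card_mono) auto
        then show ?thesis by simp
      qed
    next
      fix B m \<gamma> assume "B \<in> Pow ?E - bad" "m \<in> ?I" "\<gamma> \<in> ?P m"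
      then show "d \<le> card (\<gamma> \<inter> B)" unfolding bad_def by (force simp: not_less[symmetric])
    qed (use l t nk card_strip_le strip_paths_subset in \<open>auto simp: strips_edges_def\<close>)
    also have "\<dots> \<le> 2 ^ card ?E * \<Delta>"
      unfolding \<Delta>_def using cardI l
      by (intro mult_left_mono add_left_mono mult_right_mono of_nat_mono) auto
    finally show ?thesis using d by (simp add: field_simps)
  qed
  let ?X = "bad \<union> (\<Union>i<Q. near (x + real i * \<delta>))"
  have "measure (weight_space a b) {\<omega> \<in> space (weight_space a b). tau n k \<omega> \<in> {x..x + c}}
      \<le> real (card ?X) / 2 ^ card ?E"
  proof (rule measure_weight_space_le[OF ab])
    show "?E \<subseteq> lattice_edges" using strip_lattice_edges by (auto simp: strips_edges_def)
    show "?X \<subseteq> Pow ?E" by (auto simp: bad_def near_def)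
  next
    fix \<omega> B assume \<omega>: "\<omega> \<in> {\<omega> \<in> space (weight_space a b). tau n k \<omega> \<in> {x..x + c}}"
      and B: "B \<subseteq> ?E" "\<forall>e\<in>?E. \<omega> e = (if e \<in> B then b else a)"
    note tau = tau_attained[OF nk B]
    let ?r = "(tau n k \<omega> - x) / \<delta>"
    define i where "i = nat \<lfloor>?r\<rfloor>"
    have r: "0 \<le> ?r" "?r \<le> c / \<delta>" using \<omega> \<delta> by (auto simp: divide_right_mono)
    then have "i < Q" unfolding i_def Q_def by (simp add: floor_mono nat_mono le_imp_less_Suc)
    have i: "real i = of_int \<lfloor>?r\<rfloor>" using r by (simp add: i_def)
    have "real i \<le> ?r" "?r < real i + 1" unfolding i by linarith+
    then have ti: "x + real i * \<delta> \<le> tau n k \<omega>" "tau n k \<omega> < x + real i * \<delta> + (b - a)"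
      using \<delta> by (simp_all add: field_simps flip: \<delta>_def)
    have "\<exists>m\<in>?I. \<exists>\<gamma>\<in>?P m. ?w B \<gamma> < x + real i * \<delta> + (b - a)"
      using tau(2) ti(2) by metis
    then have "B \<in> bad \<or> B \<in> near (x + real i * \<delta>)"
      using B(1) order_trans[OF ti(1) tau(1)] by (simp add: near_def)
    then show "B \<in> ?X" using \<open>i < Q\<close> by blast
  qed auto
  also have "\<dots> \<le> (real (card bad) + (\<Sum>i<Q. real (card (near (x + real i * \<delta>))))) / 2 ^ card ?E"
  proof -
    have "card ?X \<le> card bad + (\<Sum>i<Q. card (near (x + real i * \<delta>)))"
      by (intro order_trans[OF card_Un_le] add_left_mono card_UN_le) auto
    then have "real (card ?X) \<le> real (card bad + (\<Sum>i<Q. card (near (x + real i * \<delta>))))"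
      by (rule of_nat_mono)
    then show ?thesis by (simp add: divide_right_mono)
  qed
  also have "\<dots> \<le> (real (n + k) * (real d / 2 ^ g) * 2 ^ card ?E
      + real Q * (\<Delta> / real d * 2 ^ card ?E)) / 2 ^ card ?E"
  proof -
    have "(\<Sum>i<Q. real (card (near (x + real i * \<delta>)))) \<le> real (card {..<Q}) * (\<Delta> / real d * 2 ^ card ?E)"
      by (intro sum_bounded_above near_card)
    then show ?thesis using bad_card by (intro divide_right_mono add_mono) auto
  qed
  also have "\<dots> = real (n + k) * (real d / 2 ^ g) + real Q * (\<Delta> / real d)"
    by (simp add: add_divide_distrib)
  finally show ?thesis unfolding \<Delta>_def Q_def \<delta>_def .
qed

section \<open>Asymptotics\<close>

text \<open>Choice of parameters: \<open>g\<close> of order n^(1/10) makes the union bound smaller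
  than any power of n, at the price of this factor in \<open>d\<close>. The product l t = n^(1/20)
  dominates the exponent l^2 3 n k, which is at most 3 n^(-3/55), so the Chernoff term is negligible
  too.\<close>

lemma tau_anticoncentration_powr:
  fixes n k :: nat and a b c x :: real
  assumes ab: "a < b" and c: "0 < c" and k: "1 \<le> k" "real k \<le> real n powr (1/22)"
    and n: "1 \<le> n" "4 * real n powr (1/22) * real n powr (1/10) \<le> real n"
  shows "measure (weight_space a b) {\<omega> \<in> space (weight_space a b). tau n k \<omega> \<in> {x..x + c}}
    \<le> 2 * real n * (real n / 2 powr (real n powr (1/10))) + real (nat \<lfloor>c / (b - a)\<rfloor> + 1) *
      ((2 * real n powr (1/22) * real n powr (3/5) + 2 * real n *
         (exp (3 * real n * real n powr (1/22) * real n powr (-11/10) - real n powr (1/20)) * real n powr (11/20)))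
       * (4 * real n powr (1/22) * real n powr (1/10) / real n))"
proof -
  define g where "g = nat \<lceil>real n powr (1/10)\<rceil>"
  define d where "d = n div (k * g)"
  define l t where "l = real n powr (-11/20)" and "t = real n powr (3/5)"
  have r1: "1 \<le> real n powr (1/10)" using n by (intro ge_one_powr_ge_zero) auto
  have g: "real n powr (1/10) \<le> real g" "real g \<le> 2 * real n powr (1/10)"
    using r1 unfolding g_def by linarith+
  have "real (k * g) \<le> real n powr (1/22) * (2 * real n powr (1/10))"
    unfolding of_nat_mult using k g by (intro mult_mono) auto
  then have kg: "2 * real (k * g) \<le> 4 * real n powr (1/22) * real n powr (1/10)" by (simp add: ac_simps)
  then have "2 * real (k * g) \<le> real n" using n by linarith
  then have kgn: "k * g \<le> n" by linarith
  have g0: "0 < g" using g r1 by linarith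
  then have kg0: "0 < k * g" using k by simp
  have d1: "1 \<le> d" unfolding d_def using kgn kg0 by (simp add: Suc_le_eq div_greater_zero_iff)
  have dn: "d \<le> n" unfolding d_def by simp
  have "k * g * d \<le> n" unfolding d_def by (rule times_div_less_eq_dividend)
  then have dgk: "d * g * k \<le> n" by (simp add: ac_simps)
  have "n < k * g * (d + 1)" unfolding d_def using kg0 dividend_less_times_div[of "k * g" n] by simp
  \<comment> \<open>Rounding down in \<open>d\<close> costs at most a factor 2, as \<open>d\<close>
    is at least 1; rounding up in \<open>g\<close> costs another, whence the constant 4.\<close>
  also have "\<dots> \<le> k * g * (2 * d)" using d1 by (intro mult_left_mono) auto
  finally have "real n \<le> real (k * g * (2 * d))" by (intro of_nat_mono) simp
  then have "real n \<le> 2 * real (k * g) * real d" by simp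
  also have "\<dots> \<le> 4 * real n powr (1/22) * real n powr (1/10) * real d"
    using kg by (intro mult_right_mono) auto
  finally have inv_d: "1 / real d \<le> 4 * real n powr (1/22) * real n powr (1/10) / real n"
    using d1 n by (simp add: field_simps)
  have "k * 1 \<le> k * g" using g0 by (intro mult_left_mono) auto
  then have "k \<le> n" using kgn unfolding mult_1_right by (rule order_trans)
  then have nk: "real (n + k) \<le> 2 * real n" by simp
  have l: "0 < l" "l \<le> 1" using n powr_mono[of "-11/20" 0 "real n"] by (auto simp: l_def)
  have t: "0 \<le> t" by (simp add: t_def)
  have l2: "l^2 = real n powr (-11/10)"
    using n by (simp add: l_def powr_power)
  have lt: "l * t = real n powr (1/20)"
    using n by (simp add: l_def t_def flip: powr_add)
  have il: "1 / l = real n powr (11/20)"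
    using n by (simp add: l_def powr_minus_divide)
  have "measure (weight_space a b) {\<omega> \<in> space (weight_space a b). tau n k \<omega> \<in> {x..x + c}}
    \<le> real (n + k) * (real d / 2 ^ g) + real (nat \<lfloor>c / (b - a)\<rfloor> + 1) *
        ((real (2 * k) * t + real (n + k) * (exp (l^2 * real (3 * n * k) - l * t) / l)) / real d)"
    by (rule tau_anticoncentration[OF ab c n(1) k(1) d1 dgk l t])
  also have "\<dots> \<le> 2 * real n * (real n / 2 powr (real n powr (1/10))) + real (nat \<lfloor>c / (b - a)\<rfloor> + 1) *
      ((2 * real n powr (1/22) * t + 2 * real n *
         (exp (3 * real n * real n powr (1/22) * real n powr (-11/10) - real n powr (1/20)) * real n powr (11/20)))
       * (4 * real n powr (1/22) * real n powr (1/10) / real n))"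
  proof (intro add_mono mult_mono mult_left_mono nk)
    have "2 powr (real n powr (1/10)) \<le> 2 powr real g" using g by (intro powr_mono) auto
    then have "2 powr (real n powr (1/10)) \<le> 2 ^ g" by (simp add: powr_realpow)
    then show "real d / 2 ^ g \<le> real n / 2 powr (real n powr (1/10))"
      using dn by (intro frac_le) auto
  next
    have e: "l^2 * real (3 * n * k) \<le> 3 * real n * real n powr (1/22) * real n powr (-11/10)"
      using k n by (simp add: l2 mult_left_mono)
    have "real (2 * k) * t + real (n + k) * (exp (l^2 * real (3 * n * k) - l * t) / l)
      = real (2 * k) * t + real (n + k) * (exp (l^2 * real (3 * n * k) - real n powr (1/20)) * real n powr (11/20))"
      by (simp add: lt flip: il)
    also have "\<dots> \<le> 2 * real n powr (1/22) * t + 2 * real n *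
      (exp (3 * real n * real n powr (1/22) * real n powr (-11/10) - real n powr (1/20)) * real n powr (11/20))"
      using e k t nk by (intro add_mono mult_mono) auto
    finally have main: "real (2 * k) * t + real (n + k) * (exp (l^2 * real (3 * n * k) - l * t) / l)
      \<le> 2 * real n powr (1/22) * t + 2 * real n *
      (exp (3 * real n * real n powr (1/22) * real n powr (-11/10) - real n powr (1/20)) * real n powr (11/20))"
      (is "?lhs \<le> ?rhs") .
    have "?lhs / real d = ?lhs * (1 / real d)" by simp
    also have "\<dots> \<le> ?rhs * (4 * real n powr (1/22) * real n powr (1/10) / real n)"
      using main inv_d t by (intro mult_mono) auto
    finally show "?lhs / real d \<le> ?rhs * (4 * real n powr (1/22) * real n powr (1/10) / real n)" .
  qed (use l t in \<open>auto intro!: divide_nonneg_nonneg add_nonneg_nonneg mult_nonneg_nonneg\<close>)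
  finally show ?thesis unfolding t_def .
qed

theorem theorem1p2:
  fixes a b c \<alpha> :: real and k :: "nat \<Rightarrow> nat"
  assumes "0 < a" and "a < b" and "\<alpha> < 1/22"
    and "\<forall>n\<ge>1. 0 < k n \<and> real (k n) \<le> real n powr \<alpha>"
    and "0 < c"
  shows "(\<lambda>n. SUP x\<in>{0::real..}. measure (weight_space a b)
            {\<omega> \<in> space (weight_space a b). tau n (k n) \<omega> \<in> {x..x+c}})
         \<in> o(\<lambda>n. 1 / real n powr (1/22))"
proof -
  let ?m = "\<lambda>n x. measure (weight_space a b)
    {\<omega> \<in> space (weight_space a b). tau n (k n) \<omega> \<in> {x..x+c}}"
  define Q where "Q = real (nat \<lfloor>c / (b - a)\<rfloor> + 1)"
  define h where "h n = 2 * real n * (real n / 2 powr (real n powr (1/10))) + Q *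
      ((2 * real n powr (1/22) * real n powr (3/5) + 2 * real n *
         (exp (3 * real n * real n powr (1/22) * real n powr (-11/10) - real n powr (1/20)) * real n powr (11/20)))
       * (4 * real n powr (1/22) * real n powr (1/10) / real n))" for n :: nat
  \<comment> \<open>The dominant term has order n^(2/22 + 3/5 + 1/10 - 1) = n^(-23/110), and 23/110
    exceeds 1/22 = 5/110.\<close>
  have "h \<in> o(\<lambda>n. 1 / real n powr (1/22))"
    unfolding h_def by real_asymp
  moreover have "(\<lambda>n. SUP x\<in>{0::real..}. ?m n x) \<in> O(h)"
  proof (rule bigoI[where c = 1])
    have "eventually (\<lambda>n::nat. 4 * real n powr (1/22) * real n powr (1/10) \<le> real n) at_top"
      by real_asymp
    then show "eventually (\<lambda>n. norm (SUP x\<in>{0::real..}. ?m n x) \<le> 1 * norm (h n)) at_top"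
      using eventually_ge_at_top[of 1]
    proof eventually_elim
      case (elim n)
      have "real n powr \<alpha> \<le> real n powr (1/22)"
        using elim assms by (intro powr_mono) auto
      then have k: "1 \<le> k n" "real (k n) \<le> real n powr (1/22)"
        using assms(4) elim by (force intro: order_trans)+
      have le: "?m n x \<le> h n" for x
        unfolding h_def Q_def
        by (rule tau_anticoncentration_powr[OF assms(2,5) k elim(2,1)])
      have "(SUP x\<in>{0::real..}. ?m n x) \<le> h n"
        using le by (intro cSUP_least) auto
      \<comment> \<open>The uniform bound by \<open>h n\<close> makes the supremum one of a bounded
        set, so it is at least its value at 0.\<close>
      moreover have "0 \<le> (SUP x\<in>{0::real..}. ?m n x)"
      proof (rule order_trans)
        show "0 \<le> ?m n 0" by (rule measure_nonneg)
        show "?m n 0 \<le> (SUP x\<in>{0::real..}. ?m n x)"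
          using le by (intro cSUP_upper bdd_aboveI2) auto
      qed
      ultimately show ?case by simp
    qed
  qed
  ultimately show ?thesis by (rule landau_o.big_small_trans[rotated])
qed

end
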